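(* Let $E$ and $F$ be Fréchet spaces, and let $f, g : E \to F$ be continuous linear maps. Assume that $g$ is onto, and that there exists an open symmetric neighborhood $U$ of $0$ in $E$ such that the closure $\overline{f(U)}$ is compact in $F$ and $\overline{f(U)} \subseteq \frac{1}{2}\, g(U)$. Then $h = f + g : E \to F$ is also onto.
   Context: A Fréchet space is a complete, metrizable (Hausdorff) locally convex topological vector space; $E$ and $F$ are over the same scalar field, $\mathbb{R}$ or $\mathbb{C}$. A set $U \subseteq E$ is symmetric if $-U = U$. For a set $A$ and scalar $c$, $cA = \{ca : a \in A\}$. *)

theory Defs
  imports "HOL-Analysis.Analysis"
begin

(*
  The scalar field is a real_normed_field. By the Gelfand-Mazur theorem such a field is
  isometrically isomorphic to the reals or the complex numbers, and both are instances, so the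
  class captures exactly the two usual choices.

  The carrier type is also a real vector space; of_real_scale says that this is just the
  restriction of the given scalar multiplication to real scalars. It makes the library's notion
  of convexity available whichever field is used, and for real scalars it forces
  scale = scaleR.
*)

locale topological_vector_space = vector_space scale
  for scale :: "'k::real_normed_field \<Rightarrow> 'a::{real_vector, topological_ab_group_add} \<Rightarrow> 'a" +
  assumes of_real_scale: "scale (of_real r) x = r *\<^sub>R x"
    and continuous_scale: "continuous_on UNIV (\<lambda>(c, x). scale c x)"

(*
  The uniformity of the carrier type is required to be the translation-invariant one induced by
  the vector topology, so that complete UNIV means completeness as a topological vector space:
  every Cauchy filter (hence every Cauchy sequence) converges. Metrizability includes the
  Hausdorff property.
*)

locale frechet_space = topological_vector_space scale
  for scale :: "'k::real_normed_field \<Rightarrow>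
      'a::{real_vector, topological_ab_group_add, uniform_space} \<Rightarrow> 'a" +
  assumes locally_convex:
      "open (W :: 'a set) \<Longrightarrow> 0 \<in> W \<Longrightarrow> \<exists>V. open V \<and> convex V \<and> 0 \<in> V \<and> V \<subseteq> W"
    and metrizable: "metrizable_space (euclidean :: 'a topology)"
    and uniformity_translation:
      "(uniformity :: ('a \<times> 'a) filter) = filtercomap (\<lambda>(x, y). x - y) (nhds 0)"
    and complete_UNIV: "complete (UNIV :: 'a set)"

end

theory Submission
  imports Defs
begin

text \<open>
  Baire's theorem makes \<open>g\<close> nearly open, and successive approximation by finite sets then lifts the
  compact set \<open>2 cl(f U) \<subseteq> g U\<close> to a totally bounded \<open>B \<subseteq> U\<close>. Starting from \<open>u\<^sub>0 \<in> U\<close>, choose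
  \<open>u\<^sub>n\<^sub>+\<^sub>1 \<in> B\<close> with \<open>f u\<^sub>n = (1/2) g u\<^sub>n\<^sub>+\<^sub>1\<close>. As \<open>B\<close> is bounded and the topology is locally convex,
  \<open>s = u\<^sub>1/2 - u\<^sub>2/4 + u\<^sub>3/8 - \<dots>\<close> converges, and \<open>f s + g s\<close> telescopes to \<open>f u\<^sub>0\<close>. Hence the range
  of \<open>f + g\<close> contains \<open>f U\<close>, then the range of \<open>f\<close> because \<open>U\<close> is absorbing, and finally the range
  of \<open>g = (f + g) - f\<close>.
\<close>

section \<open>Convexity, translates and closures\<close>

text \<open>Splitting off the first term shows the sum as the midpoint of
  \<open>2 *\<^sub>R x 0\<close> and the sum of the doubled, shifted sequence, which satisfies the
  same hypothesis. Tails of geometric type are bounded this way below.\<close>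

lemma half_sums_mem_convex:
  fixes V :: "'a::real_vector set"
  assumes "convex V" "0 \<in> V" "\<And>j. 2 ^ Suc j *\<^sub>R x j \<in> V"
  shows "(\<Sum>j<n. x j) \<in> V"
  using assms(3)
proof (induction n arbitrary: x)
  case 0
  then show ?case using assms(2) by simp
next
  case (Suc n)
  have "(\<Sum>j<n. 2 *\<^sub>R x (Suc j)) \<in> V"
  proof (rule Suc.IH)
    show "2 ^ Suc j *\<^sub>R 2 *\<^sub>R x (Suc j) \<in> V" for j
      using Suc.prems[of "Suc j"] by (simp add: mult_ac)
  qed
  then have "(1/2) *\<^sub>R (2 *\<^sub>R x 0) + (1/2) *\<^sub>R (\<Sum>j<n. 2 *\<^sub>R x (Suc j)) \<in> V"
    using Suc.prems[of 0] by (intro convexD[OF assms(1)]) auto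
  then show ?case
    by (simp add: sum.lessThan_Suc_shift scaleR_sum_right del: sum.lessThan_Suc)
qed

lemma convex_scaleR_mem:
  assumes "convex V" "0 \<in> V" "x \<in> V" "0 \<le> c" "c \<le> 1"
  shows "c *\<^sub>R x \<in> V"
  using convexD[OF assms(1,3,2), of c "1 - c"] assms(4,5) by simp

lemma open_translate:
  fixes W :: "'a::topological_ab_group_add set"
  assumes "open W"
  shows "open {z. z - a \<in> W}"
  using open_vimage[OF assms, of "\<lambda>z. z - a"]
  by (simp add: vimage_def continuous_on_def tendsto_diff)

text \<open>Subtraction is continuous, and the closure of a product is the product of the
  closures.\<close>

lemma closure_diff_mem:
  fixes A B :: "'a::topological_ab_group_add set"
  assumes "a \<in> closure A" "b \<in> closure B"
  shows "a - b \<in> closure {x - y | x y. x \<in> A \<and> y \<in> B}"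
proof -
  have "continuous_on (closure (A \<times> B)) (\<lambda>z. fst z - snd z)"
    unfolding continuous_on_def by (intro ballI tendsto_diff tendsto_fst tendsto_snd tendsto_ident_at)
  then have "(\<lambda>z. fst z - snd z) ` closure (A \<times> B) \<subseteq> closure {x - y | x y. x \<in> A \<and> y \<in> B}"
    by (rule image_closure_subset) (use closure_subset in force)+
  then show ?thesis
    using assms by (force simp: closure_Times)
qed

section \<open>Restriction to real scalars\<close>

text \<open>Topology, uniformity and convexity do not involve \<open>scale\<close>, so only joint
  continuity has to be pulled back along \<open>of_real\<close>. The main argument can then run over
  the reals.\<close>

lemma frechet_space_scaleR:
  fixes scale :: "'k::real_normed_field \<Rightarrow>
      'a::{real_vector, topological_ab_group_add, uniform_space} \<Rightarrow> 'a"
  assumes "frechet_space scale"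
  shows "frechet_space (scaleR :: real \<Rightarrow> 'a \<Rightarrow> 'a)"
proof -
  interpret frechet_space scale by fact
  have "continuous_on UNIV ((\<lambda>(c, x). scale c x) \<circ> (\<lambda>(c, x::'a). (of_real c :: 'k, x)))"
    by (intro continuous_on_compose continuous_on_subset[OF continuous_scale] subset_UNIV)
      (auto simp: case_prod_unfold intro!: continuous_intros)
  then have *: "continuous_on UNIV (\<lambda>(c::real, x::'a). c *\<^sub>R x)"
    by (simp add: o_def case_prod_unfold of_real_scale)
  show ?thesis
    by unfold_locales
      (use * locally_convex metrizable uniformity_translation complete_UNIV in \<open>auto simp: algebra_simps\<close>)
qed

lemma linear_scaleR:
  fixes scaleE :: "'k::real_normed_field \<Rightarrow> 'e::{real_vector, topological_ab_group_add} \<Rightarrow> 'e"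
    and scaleF :: "'k \<Rightarrow> 'f::{real_vector, topological_ab_group_add} \<Rightarrow> 'f"
  assumes "topological_vector_space scaleE" "topological_vector_space scaleF"
    and "Vector_Spaces.linear scaleE scaleF f"
  shows "linear f"
proof -
  interpret E: topological_vector_space scaleE by fact
  interpret F: topological_vector_space scaleF by fact
  interpret f: Vector_Spaces.linear scaleE scaleF f by fact
  show ?thesis
    by (rule linearI) (metis f.add, metis f.scale E.of_real_scale F.of_real_scale)
qed

section \<open>Convex neighbourhoods and countable bases at 0\<close>

context frechet_space
begin

lemma tendsto_scaleR_tvs:
  fixes x :: 'a
  assumes "(c \<longlongrightarrow> a) F" "(y \<longlongrightarrow> x) F"
  shows "((\<lambda>t. c t *\<^sub>R y t) \<longlongrightarrow> a *\<^sub>R x) F"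
proof -
  have "((\<lambda>t. (of_real (c t) :: 'k, y t)) \<longlongrightarrow> (of_real a, x)) F"
    by (intro tendsto_Pair tendsto_of_real assms)
  from continuous_on_tendsto_compose[OF continuous_scale this] show ?thesis
    by (simp add: of_real_scale)
qed

lemma open_scaleR_vimage:
  fixes W :: "'a set"
  assumes "open W"
  shows "open {x. c *\<^sub>R x \<in> W}"
  using open_vimage[OF assms, of "\<lambda>x. c *\<^sub>R x"]
  by (simp add: vimage_def continuous_on_def tendsto_scaleR_tvs)

lemma LIMSEQ_unique_tvs:
  fixes x y :: 'a
  assumes "s \<longlonglongrightarrow> x" "s \<longlonglongrightarrow> y"
  shows "x = y"
  using limitin_Hausdorff_unique[of euclidean s x sequentially y]
    metrizable_imp_Hausdorff_space[OF metrizable] assms by simp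

text \<open>Local convexity is applied to half of \<open>W\<close>, and intersecting with the
  reflection gives symmetry. For convex \<open>V\<close> one has \<open>V + V = 2V\<close>, so the
  factor 2 encodes the usual \<open>V + V \<subseteq> W\<close>.\<close>

lemma ex_small_convex:
  assumes "open (W :: 'a set)" "0 \<in> W"
  shows "\<exists>V. open V \<and> convex V \<and> 0 \<in> V \<and> (\<forall>x\<in>V. - x \<in> V) \<and> (\<forall>x\<in>V. 2 *\<^sub>R x \<in> W)"
proof -
  have "open {x. 2 *\<^sub>R x \<in> W}" "0 \<in> {x. 2 *\<^sub>R x \<in> W}"
    using assms open_scaleR_vimage by auto
  then obtain V where V: "open V" "convex V" "0 \<in> V" "V \<subseteq> {x. 2 *\<^sub>R x \<in> W}"
    using locally_convex by blast
  have "open (V \<inter> uminus -` V)" "convex (V \<inter> uminus -` V)"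
    using V open_scaleR_vimage[OF \<open>open V\<close>, of "-1"] convex_linear_vimage[of uminus V]
    by (auto simp: vimage_def linear_iff intro!: convex_Int)
  then show ?thesis
    using V by (intro exI[of _ "V \<inter> uminus -` V"]) auto
qed

end

text \<open>\<open>V n\<close> acts like a ball of radius \<open>2^-n\<close>, so the base replaces
  a translation-invariant metric. Stating \<open>V_Suc\<close> by doubling suits convex sets: it
  yields closure under sums (\<open>V_add\<close>) and under dyadic scaling
  (\<open>V_power\<close>).\<close>

locale frechet_base = frechet_space "scaleR :: real \<Rightarrow> 'a \<Rightarrow> 'a"
  for V :: "nat \<Rightarrow> 'a::{real_vector, topological_ab_group_add, uniform_space} set" +
  assumes V_open: "open (V n)" and V_convex: "convex (V n)" and V_0: "0 \<in> V n"
    and V_uminus: "x \<in> V n \<Longrightarrow> - x \<in> V n"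
    and V_Suc: "x \<in> V (Suc n) \<Longrightarrow> 2 *\<^sub>R x \<in> V n"
    and V_base: "open W \<Longrightarrow> 0 \<in> W \<Longrightarrow> \<exists>n. V n \<subseteq> W"

text \<open>Metrizability gives a countable base \<open>W n\<close> at 0, and
  \<open>V (Suc n)\<close> is chosen inside half of \<open>V n \<inter> W n\<close>.\<close>

lemma ex_frechet_base:
  assumes "frechet_space (scaleR :: real \<Rightarrow> 'a \<Rightarrow> 'a::{real_vector, topological_ab_group_add, uniform_space})"
  shows "\<exists>V :: nat \<Rightarrow> 'a set. frechet_base V"
proof -
  interpret frechet_space "scaleR :: real \<Rightarrow> 'a \<Rightarrow> 'a" by fact
  have "\<forall>x::'a. \<exists>\<B>. countable \<B> \<and> (\<forall>V\<in>\<B>. open V) \<and>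
      (\<forall>U. open U \<and> x \<in> U \<longrightarrow> (\<exists>V\<in>\<B>. x \<in> V \<and> V \<subseteq> U))"
    using metrizable_imp_first_countable[OF metrizable] by (simp add: first_countable_def)
  from spec[OF this, of 0] obtain \<B> :: "'a set set" where \<B>: "countable \<B>" "\<forall>V\<in>\<B>. open V"
    "\<forall>U. open U \<and> 0 \<in> U \<longrightarrow> (\<exists>V\<in>\<B>. 0 \<in> V \<and> V \<subseteq> U)"
    by (elim exE conjE) (rule that)
  define \<C> where "\<C> = {B \<in> \<B>. 0 \<in> B}"
  have "countable \<C>" "\<C> \<noteq> {}"
    using \<B>(1) \<B>(3)[rule_format, of UNIV] by (auto simp: \<C>_def)
  define W where "W = from_nat_into \<C>"
  have W: "range W = \<C>"
    using \<open>countable \<C>\<close> \<open>\<C> \<noteq> {}\<close> by (simp add: range_from_nat_into W_def)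
  have W_open: "open (W n)" "0 \<in> W n" for n
  proof -
    have "W n \<in> \<C>"
      using W by blast
    then show "open (W n)" "0 \<in> W n"
      using \<B>(2) by (simp_all add: \<C>_def)
  qed
  let ?P = "\<lambda>V::'a set. open V \<and> convex V \<and> 0 \<in> V \<and> (\<forall>x\<in>V. - x \<in> V)"
  have "\<exists>V. \<forall>n. ?P (V n) \<and> (\<forall>x\<in>V (Suc n). 2 *\<^sub>R x \<in> V n \<inter> W n)"
  proof (rule dependent_nat_choice)
    show "\<exists>V. ?P V"
      by (rule exI[of _ UNIV]) auto
    show "\<exists>V'. ?P V' \<and> (\<forall>x\<in>V'. 2 *\<^sub>R x \<in> V \<inter> W n)" if "?P V" for V n
      using ex_small_convex[of "V \<inter> W n"] that W_open[of n] by (simp add: open_Int conj_assoc)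
  qed
  then obtain V where *: "\<forall>n. ?P (V n) \<and> (\<forall>x\<in>V (Suc n). 2 *\<^sub>R x \<in> V n \<inter> W n)"
    by (rule exE)
  have V: "?P (V n)" "x \<in> V (Suc n) \<Longrightarrow> 2 *\<^sub>R x \<in> V n \<inter> W n" for n x
    using * by simp_all
  have "frechet_base V"
  proof unfold_locales
    fix U :: "'a set" assume "open U" "0 \<in> U"
    then obtain B where "B \<in> \<C>" "B \<subseteq> U"
      using \<B>(3)[rule_format, of U] by (auto simp: \<C>_def)
    then obtain n where n: "W n \<subseteq> U"
      using W by (metis rangeE)
    \<comment> \<open>The recursion controls only doubled points of \<open>V (Suc n)\<close>, so it
      is applied to half of \<open>x\<close>, which stays in \<open>V (Suc n)\<close> by
      convexity.\<close>
    have "V (Suc n) \<subseteq> U"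
    proof
      fix x assume "x \<in> V (Suc n)"
      then have "(1/2) *\<^sub>R x \<in> V (Suc n)"
        using V(1)[of "Suc n"] by (intro convex_scaleR_mem) auto
      from V(2)[OF this] show "x \<in> U" using n by auto
    qed
    then show "\<exists>n. V n \<subseteq> U" by blast
  qed (use V in auto)
  then show ?thesis by blast
qed

section \<open>Total boundedness by translates\<close>

context frechet_space
begin

text \<open>The uniformity is translation invariant, so entourages correspond to neighbourhoods of
  0. The reflected sets in the proof reconcile \<open>t - x\<close> with the library's pairs, in
  which the centre comes first.\<close>

lemma totally_bounded_iff_translates:
  fixes T :: "'a set"
  shows "totally_bounded T \<longleftrightarrow>
    (\<forall>W. open W \<longrightarrow> 0 \<in> W \<longrightarrow> (\<exists>F. finite F \<and> (\<forall>t\<in>T. \<exists>x\<in>F. t - x \<in> W)))"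
proof (intro iffI allI impI)
  fix W :: "'a set"
  assume T: "totally_bounded T" and W: "open W" "0 \<in> W"
  have "open {z. - z \<in> W}"
    using open_scaleR_vimage[OF W(1), of "-1"] by simp
  then have "eventually (\<lambda>(x, y). y - x \<in> W) uniformity"
    unfolding uniformity_translation eventually_filtercomap eventually_nhds
    using W by (intro exI[of _ "\<lambda>z. - z \<in> W"]) (auto intro!: exI[of _ "{z. - z \<in> W}"])
  then show "\<exists>F. finite F \<and> (\<forall>t\<in>T. \<exists>x\<in>F. t - x \<in> W)"
    using T unfolding totally_bounded_def by force
next
  assume *: "\<forall>W. open W \<longrightarrow> 0 \<in> W \<longrightarrow> (\<exists>F. finite F \<and> (\<forall>t\<in>T. \<exists>x\<in>F. t - x \<in> W))"
  show "totally_bounded T"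
    unfolding totally_bounded_def
  proof (intro allI impI)
    fix E :: "'a \<times> 'a \<Rightarrow> bool" assume "eventually E uniformity"
    then obtain W where W: "open W" "0 \<in> W" "\<And>x y. x - y \<in> W \<Longrightarrow> E (x, y)"
      unfolding uniformity_translation eventually_filtercomap eventually_nhds by auto
    have "open {z. - z \<in> W}"
      using open_scaleR_vimage[OF W(1), of "-1"] by simp
    with *[rule_format, of "{z. - z \<in> W}"] W(2)
    obtain F where F: "finite F" "\<forall>t\<in>T. \<exists>x\<in>F. x - t \<in> W" by auto
    show "\<exists>X. finite X \<and> (\<forall>s\<in>T. \<exists>x\<in>X. E (x, s))"
      using F(2) by (intro exI[of _ F] conjI F(1)) (blast intro: W(3))
  qed
qed

lemma totally_bounded_translate:
  fixes T :: "'a set"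
  assumes "totally_bounded T"
  shows "totally_bounded ((\<lambda>t. t - a) ` T)"
  unfolding totally_bounded_iff_translates
proof (intro allI impI)
  fix W :: "'a set" assume "open W" "0 \<in> W"
  then obtain F where "finite F" "\<forall>t\<in>T. \<exists>x\<in>F. t - x \<in> W"
    using assms unfolding totally_bounded_iff_translates by blast
  then show "\<exists>F. finite F \<and> (\<forall>t\<in>(\<lambda>t. t - a) ` T. \<exists>x\<in>F. t - x \<in> W)"
    by (intro exI[of _ "(\<lambda>t. t - a) ` F"]) auto
qed

lemma totally_bounded_translates:
  fixes T :: "'a set"
  assumes "totally_bounded T" "finite F"
  shows "totally_bounded (\<Union>a\<in>F. (\<lambda>t. t - a) ` T)"
  using assms by (intro totally_bounded_Union) (auto intro: totally_bounded_translate)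

lemma compact_imp_totally_bounded_tvs:
  fixes K :: "'a set"
  assumes "compact K"
  shows "totally_bounded K"
  unfolding totally_bounded_iff_translates
proof (intro allI impI)
  fix W :: "'a set" assume W: "open W" "0 \<in> W"
  have "K \<subseteq> (\<Union>c\<in>K. {z. z - c \<in> W})"
    using W(2) by auto
  from compactE_image[OF assms open_translate[OF W(1)] this]
  obtain C where "finite C" "K \<subseteq> (\<Union>c\<in>C. {z. z - c \<in> W})"
    by metis
  then show "\<exists>F. finite F \<and> (\<forall>t\<in>K. \<exists>x\<in>F. t - x \<in> W)"
    by (intro exI[of _ C]) auto
qed

end

section \<open>Convergence, boundedness and Baire's theorem\<close>

context frechet_base
begin

lemma V_add: "x \<in> V (Suc n) \<Longrightarrow> y \<in> V (Suc n) \<Longrightarrow> x + y \<in> V n"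
  using convexD[OF V_convex V_Suc V_Suc, of x n y "1/2" "1/2"] by simp

lemma V_diff: "x \<in> V (Suc n) \<Longrightarrow> y \<in> V (Suc n) \<Longrightarrow> x - y \<in> V n"
  using V_add[of x n "- y"] V_uminus[of y "Suc n"] by simp

lemma V_antimono: "m \<le> n \<Longrightarrow> V n \<subseteq> V m"
proof (induction rule: dec_induct)
  case (step n)
  have "V (Suc n) \<subseteq> V n"
    using V_add[of _ n 0] V_0 by force
  with step.IH show ?case by blast
qed simp

lemma V_power: "x \<in> V (n + k) \<Longrightarrow> 2 ^ k *\<^sub>R x \<in> V n"
proof (induction k arbitrary: x)
  case (Suc k)
  then show ?case
    using Suc.IH[OF V_Suc, of x] by (simp add: mult.commute)
qed simp

lemma closure_imp_near:
  assumes "x \<in> closure A"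
  obtains a where "a \<in> A" "x - a \<in> V n"
proof -
  have "open {z. z - x \<in> V n}" "x \<in> {z. z - x \<in> V n}"
    using open_translate V_open V_0 by auto
  then have "A \<inter> {z. z - x \<in> V n} \<noteq> {}"
    using assms unfolding closure_iff_nhds_not_empty by blast
  then obtain a where "a \<in> A" "a - x \<in> V n" by blast
  then show ?thesis
    using that[of a] V_uminus[of "a - x" n] by simp
qed

lemma closure_V_subset: "closure (V (Suc n)) \<subseteq> V n"
proof
  fix x assume "x \<in> closure (V (Suc n))"
  then obtain a where "a \<in> V (Suc n)" "x - a \<in> V (Suc n)"
    by (rule closure_imp_near)
  then show "x \<in> V n"
    using V_add[of a n "x - a"] by simp
qed

text \<open>Comparison with the single term \<open>s N\<close> suffices, since two later terms are
  then compared through it at the cost of one index.\<close>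

lemma Cauchy_converges:
  assumes "\<And>n. \<exists>N. \<forall>m\<ge>N. s m - s N \<in> V n"
  obtains x where "s \<longlonglongrightarrow> x"
proof -
  have "Cauchy s"
    unfolding Cauchy_uniform_iff
  proof (intro allI impI)
    fix P :: "'a \<times> 'a \<Rightarrow> bool" assume "eventually P uniformity"
    then obtain W where W: "open W" "0 \<in> W" "\<And>x y. x - y \<in> W \<Longrightarrow> P (x, y)"
      unfolding uniformity_translation eventually_filtercomap eventually_nhds by auto
    obtain n where n: "V n \<subseteq> W" using V_base W by blast
    obtain N where N: "\<forall>m\<ge>N. s m - s N \<in> V (Suc n)" using assms by blast
    have "s m - s k \<in> W" if "m \<ge> N" "k \<ge> N" for m k
      using V_diff[of "s m - s N" n "s k - s N"] N that n by auto
    then show "\<exists>N. \<forall>n\<ge>N. \<forall>m\<ge>N. P (s n, s m)"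
      using W by blast
  qed
  then have "\<exists>x\<in>UNIV. filtermap s sequentially \<le> nhds x"
    using complete_UNIV[unfolded complete_uniform, rule_format, of "filtermap s sequentially"]
    by (simp add: Cauchy_uniform filtermap_bot_iff)
  then show ?thesis
    using that by (auto simp: filterlim_def)
qed

text \<open>Scaling sends the finitely many net points into \<open>V (Suc n)\<close>, while the
  remainders stay there by convexity. For a singleton this says that \<open>V n\<close> is
  absorbing.\<close>

lemma totally_bounded_imp_absorbed:
  assumes "totally_bounded B"
  obtains N where "\<forall>u\<in>B. (1 / 2 ^ N) *\<^sub>R u \<in> V n"
proof -
  obtain F where F: "finite F" "\<forall>t\<in>B. \<exists>x\<in>F. t - x \<in> V (Suc n)"
    using assms V_open V_0 unfolding totally_bounded_iff_translates by metis
  have "\<forall>\<^sub>F N in sequentially. (1 / 2 ^ N) *\<^sub>R x \<in> V (Suc n)" for x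
  proof -
    have "(\<lambda>N. (1 / 2 ^ N :: real) *\<^sub>R x) \<longlonglongrightarrow> 0 *\<^sub>R x"
      by (intro tendsto_scaleR_tvs tendsto_const) (simp add: LIMSEQ_divide_realpow_zero)
    from topological_tendstoD[OF this V_open] show ?thesis
      using V_0 by simp
  qed
  then have "\<forall>\<^sub>F N in sequentially. \<forall>x\<in>F. (1 / 2 ^ N) *\<^sub>R x \<in> V (Suc n)"
    using F(1) by (simp add: eventually_ball_finite)
  then obtain N where N: "\<forall>x\<in>F. (1 / 2 ^ N) *\<^sub>R x \<in> V (Suc n)"
    by (auto simp: eventually_sequentially)
  have "(1 / 2 ^ N) *\<^sub>R u \<in> V n" if u: "u \<in> B" for u
  proof -
    obtain x where x: "x \<in> F" "u - x \<in> V (Suc n)" using F u by blast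
    have "(1 / 2 ^ N) *\<^sub>R (u - x) \<in> V (Suc n)"
      by (rule convex_scaleR_mem[OF V_convex V_0 x(2)]) auto
    from V_add[OF this, of "(1 / 2 ^ N) *\<^sub>R x"] N x(1) show ?thesis
      by (simp add: algebra_simps)
  qed
  then show ?thesis using that by blast
qed

text \<open>If all interiors were empty, one could nest open sets of shrinking size, the closure of
  the next avoiding \<open>C n\<close>. Points chosen in them form a Cauchy sequence whose limit
  lies in no \<open>C n\<close>.\<close>

lemma Baire:
  assumes "\<And>n::nat. closed (C n)" "(\<Union>n. C n) = (UNIV :: 'a set)"
  obtains n where "interior (C n) \<noteq> {}"
proof (rule ccontr)
  assume "\<not> thesis"
  then have empty: "interior (C n) = {}" for n using that by blast
  let ?P = "\<lambda>S::'a set. open S \<and> S \<noteq> {}"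
  let ?Q = "\<lambda>n S S'. closure S' \<subseteq> S - C n \<and> (\<forall>a\<in>S'. \<forall>b\<in>S'. a - b \<in> V n)"
  have "\<exists>S. \<forall>n. ?P (S n) \<and> ?Q n (S n) (S (Suc n))"
  proof (rule dependent_nat_choice)
    show "\<exists>S. ?P S" by (rule exI[of _ UNIV]) auto
  next
    fix S :: "'a set" and n
    assume S: "?P S"
    have "\<not> S \<subseteq> C n"
      using S empty[of n] interior_maximal[of S "C n"] by auto
    then obtain x where x: "x \<in> S - C n" by blast
    have "open {z. z + x \<in> S - C n}"
      using open_translate[of "S - C n" "- x"] S assms(1) by (simp add: open_Diff)
    then obtain k where k: "V k \<subseteq> {z. z + x \<in> S - C n}"
      using V_base[of "{z. z + x \<in> S - C n}"] x by auto
    \<comment> \<open>\<open>k\<close> keeps the closure inside \<open>S - C n\<close>,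
      \<open>n\<close> bounds the diameter, and \<open>Suc\<close> pays for one sum or
      difference.\<close>
    define j where "j = Suc (max k n)"
    define S' where "S' = {z. z - x \<in> V j}"
    have diff: "a - b \<in> V (max k n)" if "a \<in> S'" "b \<in> S'" for a b
      using V_diff[of "a - x" "max k n" "b - x"] that by (simp add: S'_def j_def)
    have "closure S' \<subseteq> S - C n"
    proof
      fix z assume "z \<in> closure S'"
      then obtain a where a: "a \<in> S'" "z - a \<in> V j" by (rule closure_imp_near)
      have "z - x \<in> V (max k n)"
        using V_add[of "a - x" "max k n" "z - a"] a by (simp add: S'_def j_def)
      then have "z - x \<in> V k" using V_antimono[of k "max k n"] by auto
      then show "z \<in> S - C n" using k by auto
    qed
    moreover have "\<forall>a\<in>S'. \<forall>b\<in>S'. a - b \<in> V n"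
      using diff V_antimono[of n "max k n"] by auto
    moreover have "open S'" "x \<in> S'"
      using open_translate[OF V_open] V_0 by (simp_all add: S'_def)
    ultimately show "\<exists>S'. ?P S' \<and> ?Q n S S'" by blast
  qed
  then obtain S where S: "\<forall>n. ?P (S n) \<and> ?Q n (S n) (S (Suc n))"
    by (rule exE)
  have "S (Suc n) \<subseteq> S n" for n
    using S closure_subset[of "S (Suc n)"] by blast
  then have anti: "S m \<subseteq> S n" if "n \<le> m" for m n
    using that by (rule lift_Suc_antimono_le)
  define s where "s n = (SOME x. x \<in> S n)" for n
  have s: "s n \<in> S n" for n
    using S by (auto simp: s_def some_in_eq)
  obtain x where x: "s \<longlonglongrightarrow> x"
  proof (rule Cauchy_converges)
    show "\<exists>N. \<forall>m\<ge>N. s m - s N \<in> V n" for n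
      using S s anti by (intro exI[of _ "Suc n"]) blast
  qed
  have "x \<in> closure (S (Suc n))" for n
  proof (rule Lim_in_closed_set[OF closed_closure _ _ x])
    show "\<forall>\<^sub>F m in sequentially. s m \<in> closure (S (Suc n))"
      using s anti closure_subset by (intro eventually_sequentiallyI[of "Suc n"]) blast
  qed simp
  then have "x \<notin> C n" for n using S by blast
  then show False using assms(2) by blast
qed

end

section \<open>Near openness of continuous linear surjections\<close>

locale frechet_surjection =
  E: frechet_base V + F: frechet_base W
  for V :: "nat \<Rightarrow> 'e::{real_vector, topological_ab_group_add, uniform_space} set"
    and W :: "nat \<Rightarrow> 'f::{real_vector, topological_ab_group_add, uniform_space} set" +
  fixes g :: "'e \<Rightarrow> 'f"
  assumes lin: "linear g" and cont: "continuous_on UNIV g" and surj: "surj g"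
begin

text \<open>Continuity of \<open>g\<close>, with one index spent on the closure. It later forces the
  residuals of the approximation to tend to 0.\<close>

lemma ex_closure_image_small: "\<exists>i. closure (g ` V i) \<subseteq> W n"
proof -
  have "open (g -` W (Suc n))" "0 \<in> g -` W (Suc n)"
    using open_vimage[OF F.V_open cont] F.V_0 linear_0[OF lin] by auto
  then obtain i where "V i \<subseteq> g -` W (Suc n)" using E.V_base by blast
  then have "closure (g ` V i) \<subseteq> closure (W (Suc n))"
    by (intro closure_mono) auto
  then show ?thesis using F.closure_V_subset by blast
qed

text \<open>The dilates of \<open>?A\<close> by \<open>2 ^ j\<close> cover the target because
  \<open>g\<close> is onto and \<open>V (Suc n)\<close> is absorbing, so by Baire one of them has an
  interior point. Differences of points of \<open>?A\<close> then fill a neighbourhood of 0.\<close>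

lemma nearly_open: "\<exists>k. W k \<subseteq> closure (g ` V n)"
proof -
  let ?A = "closure (g ` V (Suc n))"
  define C where "C j = {y. (1 / 2 ^ j) *\<^sub>R y \<in> ?A}" for j :: nat
  have "closed (C j)" for j
    using F.open_scaleR_vimage[OF open_Compl[OF closed_closure], of "1 / 2 ^ j"]
    by (simp add: closed_def C_def Collect_neg_eq)
  moreover have "(\<Union>j. C j) = UNIV"
  proof -
    have "\<exists>j. y \<in> C j" for y
    proof -
      obtain x where x: "y = g x" using surj by blast
      obtain j where "\<forall>u\<in>{x}. (1 / 2 ^ j) *\<^sub>R u \<in> V (Suc n)"
        by (rule E.totally_bounded_imp_absorbed[of "{x}"]) (simp add: E.compact_imp_totally_bounded_tvs)
      then have "(1 / 2 ^ j) *\<^sub>R y \<in> g ` V (Suc n)"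
        by (auto simp: x linear_scale[OF lin, symmetric])
      then show ?thesis
        unfolding C_def using closure_subset by blast
    qed
    then show ?thesis by blast
  qed
  ultimately obtain j where "interior (C j) \<noteq> {}" by (rule F.Baire)
  then obtain y where y: "y \<in> interior (C j)" by blast
  have "open {z. z + y \<in> interior (C j)}"
    using open_translate[of "interior (C j)" "- y"] by simp
  moreover have "0 \<in> {z. z + y \<in> interior (C j)}" using y by simp
  ultimately obtain i where i: "W i \<subseteq> {z. z + y \<in> interior (C j)}"
    using F.V_base by blast
  \<comment> \<open>The extra \<open>j\<close> undoes the dilation: \<open>2 ^ j *\<^sub>R z\<close>
    lies in \<open>W i\<close>, and \<open>z\<close> is the difference of the two points of
    \<open>?A\<close> in \<open>a\<close> and \<open>b\<close>.\<close>
  have "z \<in> closure (g ` V n)" if z: "z \<in> W (i + j)" for z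
  proof -
    have "2 ^ j *\<^sub>R z + y \<in> C j"
      using i F.V_power[OF z] interior_subset by blast
    then have a: "z + (1 / 2 ^ j) *\<^sub>R y \<in> ?A"
      by (simp add: C_def scaleR_add_right)
    have b: "(1 / 2 ^ j) *\<^sub>R y \<in> ?A"
      using y interior_subset by (auto simp: C_def)
    have "z \<in> closure {u - v |u v. u \<in> g ` V (Suc n) \<and> v \<in> g ` V (Suc n)}"
      using closure_diff_mem[OF a b] by simp
    also have "\<dots> \<subseteq> closure (g ` V n)"
    proof (rule closure_mono, safe)
      fix p q assume "p \<in> V (Suc n)" "q \<in> V (Suc n)"
      then show "g p - g q \<in> g ` V n"
        using E.V_diff[of p n q] linear_diff[OF lin, of p q] by force
    qed
    finally show ?thesis .
  qed
  then show ?thesis by blast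
qed

section \<open>Lifting totally bounded and compact sets through \<open>g\<close>\<close>

text \<open>One round of successive approximation. A finite net for \<open>T\<close> means that
  finitely many corrections serve all of \<open>T\<close> at once, and the residuals in
  \<open>T'\<close> allow the next round.\<close>

lemma approximation_step:
  assumes "totally_bounded T" "T \<subseteq> closure (g ` V n)"
  obtains F T' where "finite F" "F \<subseteq> V n" "totally_bounded T'" "T' \<subseteq> closure (g ` V (Suc n))"
    "\<forall>t\<in>T. \<exists>x\<in>F. t - g x \<in> T'"
proof -
  obtain k where k: "W k \<subseteq> closure (g ` V (Suc n))" using nearly_open by blast
  let ?k = "Suc (Suc k)"
  obtain C where C: "finite C" "\<forall>t\<in>T. \<exists>c\<in>C. t - c \<in> W ?k"
    using assms(1) F.V_open F.V_0 unfolding F.totally_bounded_iff_translates by metis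
  \<comment> \<open>A centre \<open>c\<close> may lie outside \<open>T\<close>, so it is replaced by
    a nearby \<open>t0\<close> of \<open>T\<close>, itself near some \<open>g x\<close>. Passing
    from \<open>t\<close> over \<open>t0\<close> to \<open>g x\<close> takes a difference and a sum,
    hence two indices. A centre near no point of \<open>T\<close> gets the default 0.\<close>
  have "\<exists>x\<in>V n. \<forall>t\<in>T. t - c \<in> W ?k \<longrightarrow> t - g x \<in> W k" for c
  proof (cases "\<exists>t\<in>T. t - c \<in> W ?k")
    case True
    then obtain t0 where t0: "t0 \<in> T" "t0 - c \<in> W ?k" by blast
    then obtain x where x: "x \<in> V n" "t0 - g x \<in> W (Suc k)"
      using F.closure_imp_near[of t0 "g ` V n"] assms(2) by blast
    have "t - g x \<in> W k" if "t - c \<in> W ?k" for t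
      using F.V_add[OF F.V_diff[OF that t0(2)] x(2)] by simp
    with x(1) show ?thesis by blast
  qed (use E.V_0 in blast)
  then obtain x where x: "\<And>c. x c \<in> V n" "\<And>c t. t \<in> T \<Longrightarrow> t - c \<in> W ?k \<Longrightarrow> t - g (x c) \<in> W k"
    by metis
  define T' where "T' = (\<Union>a\<in>g ` x ` C. (\<lambda>t. t - a) ` T) \<inter> W k"
  show ?thesis
  proof
    show "finite (x ` C)" "x ` C \<subseteq> V n" using C(1) x(1) by auto
    have "totally_bounded (\<Union>a\<in>g ` x ` C. (\<lambda>t. t - a) ` T)"
      using assms(1) C(1) by (intro F.totally_bounded_translates) auto
    then show "totally_bounded T'"
      by (rule totally_bounded_subset) (simp add: T'_def)
    show "T' \<subseteq> closure (g ` V (Suc n))" using k by (auto simp: T'_def)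
    show "\<forall>t\<in>T. \<exists>y\<in>x ` C. t - g y \<in> T'"
      using C(2) x(2) by (fastforce simp: T'_def)
  qed
qed

text \<open>The corrections \<open>x k\<close> sum to a preimage of \<open>r 0\<close>, as the
  residuals telescope and tend to 0. Of the two spare indices, one pays for summing a tail and one
  for passing to the limit.\<close>

lemma series_lift:
  assumes x: "\<And>k. x k \<in> V (Suc (Suc (m + k)))"
    and r: "\<And>k. r k \<in> closure (g ` V (Suc (Suc (m + k))))" "\<And>k. r (Suc k) = r k - g (x k)"
  obtains s where "g s = r 0" "\<forall>a. s - (\<Sum>k<a. x k) \<in> V (m + a)"
proof -
  define S where "S n = (\<Sum>k<n. x k)" for n
  have tail: "S (a + n) - S a \<in> V (Suc (m + a))" for a n
  proof -
    have "(\<Sum>j<n. x (a + j)) \<in> V (Suc (m + a))"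
    proof (rule half_sums_mem_convex[OF E.V_convex E.V_0])
      show "2 ^ Suc j *\<^sub>R x (a + j) \<in> V (Suc (m + a))" for j
        using x[of "a + j"] by (intro E.V_power) (simp add: add_ac)
    qed
    moreover have "S (a + n) = S a + (\<Sum>j<n. x (a + j))"
      by (induction n) (simp_all add: S_def add_ac)
    ultimately show ?thesis by simp
  qed
  obtain s where s: "S \<longlonglongrightarrow> s"
  proof (rule E.Cauchy_converges)
    fix n
    have "S m' - S n \<in> V n" if "m' \<ge> n" for m'
      using tail[of n "m' - n"] E.V_antimono[of n "Suc (m + n)"] that by auto
    then show "\<exists>N. \<forall>m'\<ge>N. S m' - S N \<in> V n" by blast
  qed
  have "s - S a \<in> V (m + a)" for a
  proof -
    have "(\<lambda>n. S n - S a) \<longlonglongrightarrow> s - S a"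
      by (intro tendsto_diff s tendsto_const)
    moreover have "\<forall>\<^sub>F n in sequentially. S n - S a \<in> closure (V (Suc (m + a)))"
    proof (rule eventually_sequentiallyI[of a])
      show "S n - S a \<in> closure (V (Suc (m + a)))" if "a \<le> n" for n
        using tail[of a "n - a"] closure_subset that by auto
    qed
    ultimately have "s - S a \<in> closure (V (Suc (m + a)))"
      using Lim_in_closed_set[OF closed_closure] by force
    then show ?thesis using E.closure_V_subset by blast
  qed
  moreover have "g s = r 0"
  proof -
    have "r n = r 0 - g (S n)" for n
      by (induction n) (simp_all add: S_def r(2) linear_0[OF lin] linear_add[OF lin])
    then have gS: "g (S n) = r 0 - r n" for n by (simp add: algebra_simps)
    have "r \<longlonglongrightarrow> 0"
    proof (rule topological_tendstoI)
      fix U :: "'f set" assume "open U" "0 \<in> U"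
      then obtain j i where "W j \<subseteq> U" "closure (g ` V i) \<subseteq> W j"
        using F.V_base ex_closure_image_small by metis
      moreover have "closure (g ` V (Suc (Suc (m + n)))) \<subseteq> closure (g ` V i)" if "n \<ge> i" for n
        using that by (intro closure_mono image_mono E.V_antimono) simp
      ultimately show "\<forall>\<^sub>F n in sequentially. r n \<in> U"
        using r(1) by (intro eventually_sequentiallyI[of i]) blast
    qed
    then have "(\<lambda>n. g (S n)) \<longlonglongrightarrow> r 0 - 0"
      unfolding gS by (intro tendsto_diff tendsto_const)
    moreover have "(\<lambda>n. g (S n)) \<longlonglongrightarrow> g s"
      using continuous_on_tendsto_compose[OF cont s] by simp
    ultimately show ?thesis
      using F.LIMSEQ_unique_tvs by force
  qed
  ultimately show ?thesis
    using that by (simp add: S_def)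
qed

text \<open>
  With a singleton for \<open>T\<close> this lemma is the open mapping theorem: it replaces the closure of
  the image of a neighbourhood by the image of a larger neighbourhood.
\<close>

lemma lift_totally_bounded:
  assumes "totally_bounded T" "T \<subseteq> closure (g ` V (Suc (Suc m)))"
  obtains B where "totally_bounded B" "B \<subseteq> V m" "T \<subseteq> g ` B"
proof -
  let ?V = "\<lambda>k. V (Suc (Suc (m + k)))"
  \<comment> \<open>The clause for \<open>k = 0\<close> carries the initial value through dependent
    choice.\<close>
  let ?P = "\<lambda>k T'. totally_bounded T' \<and> T' \<subseteq> closure (g ` ?V k) \<and> (k = 0 \<longrightarrow> T' = T)"
  let ?Q = "\<lambda>k T' T''. \<exists>F. finite F \<and> F \<subseteq> ?V k \<and> (\<forall>t\<in>T'. \<exists>x\<in>F. t - g x \<in> T'')"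
  have "\<exists>R. \<forall>k. ?P k (R k) \<and> ?Q k (R k) (R (Suc k))"
  proof (rule dependent_nat_choice)
    show "\<exists>T'. ?P 0 T'" using assms by auto
  next
    fix T' k assume "?P k T'"
    then show "\<exists>T''. ?P (Suc k) T'' \<and> ?Q k T' T''"
      using approximation_step[of T' "Suc (Suc (m + k))"]
      by (metis add_Suc_right nat.distinct(1))
  qed
  then obtain R where R: "\<forall>k. ?P k (R k) \<and> ?Q k (R k) (R (Suc k))" by (rule exE)
  then have "\<forall>k. \<exists>F. finite F \<and> F \<subseteq> ?V k \<and> (\<forall>t\<in>R k. \<exists>x\<in>F. t - g x \<in> R (Suc k))" by blast
  then obtain F where F: "\<forall>k. finite (F k) \<and> F k \<subseteq> ?V k \<and> (\<forall>t\<in>R k. \<exists>x\<in>F k. t - g x \<in> R (Suc k))"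
    by metis
  \<comment> \<open>\<open>S a\<close> consists of all sums with one term from each
    \<open>F k\<close>, \<open>k < a\<close>. The \<open>F k\<close> are common to all points of
    \<open>T\<close>, so it is finite.\<close>
  define S where "S = rec_nat {0} (\<lambda>k A. (\<lambda>(a, x). a + x) ` (A \<times> F k))"
  have S_finite: "finite (S a)" for a
    using F by (induction a) (auto simp: S_def)
  have S_sum: "(\<Sum>k<a. x k) \<in> S a" if "\<And>k. x k \<in> F k" for x a
  proof (induction a)
    case (Suc a)
    then have "((\<Sum>k<a. x k), x a) \<in> S a \<times> F a" using that by simp
    then show ?case by (force simp: S_def)
  qed (simp add: S_def)
  \<comment> \<open>Approximability by \<open>S a\<close> at every scale makes \<open>B\<close>
    totally bounded at once, and \<open>series_lift\<close> puts the chosen preimages into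
    it.\<close>
  define B where "B = {b \<in> V m. \<forall>a. \<exists>s\<in>S a. b - s \<in> V (m + a)}"
  show ?thesis
  proof
    show "B \<subseteq> V m" by (auto simp: B_def)
    show "totally_bounded B"
      unfolding E.totally_bounded_iff_translates
    proof (intro allI impI)
      fix U :: "'e set" assume "open U" "0 \<in> U"
      then obtain n where "V n \<subseteq> U" using E.V_base by blast
      then have "V (m + n) \<subseteq> U" using E.V_antimono[of n "m + n"] by auto
      then show "\<exists>F. finite F \<and> (\<forall>t\<in>B. \<exists>x\<in>F. t - x \<in> U)"
        using S_finite unfolding B_def by (intro exI[of _ "S n"]) blast
    qed
    show "T \<subseteq> g ` B"
    proof
      fix y assume y: "y \<in> T"
      have "\<exists>r. \<forall>k. (r k \<in> R k \<and> (k = 0 \<longrightarrow> r k = y)) \<and> (\<exists>x\<in>F k. r (Suc k) = r k - g x)"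
      proof (rule dependent_nat_choice)
        show "\<exists>r. r \<in> R 0 \<and> (0 = (0::nat) \<longrightarrow> r = y)" using R y by auto
      next
        fix r k assume "r \<in> R k \<and> (k = 0 \<longrightarrow> r = y)"
        then show "\<exists>r'. (r' \<in> R (Suc k) \<and> (Suc k = 0 \<longrightarrow> r' = y)) \<and> (\<exists>x\<in>F k. r' = r - g x)"
          using F by blast
      qed
      then obtain r where r: "\<forall>k. (r k \<in> R k \<and> (k = 0 \<longrightarrow> r k = y)) \<and> (\<exists>x\<in>F k. r (Suc k) = r k - g x)"
        by (rule exE)
      then obtain x where x: "\<And>k. x k \<in> F k" "\<And>k. r (Suc k) = r k - g (x k)" by metis
      have "x k \<in> ?V k" for k using x(1) F by blast
      moreover have "r k \<in> closure (g ` ?V k)" for k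
        using r[rule_format, of k] R[rule_format, of k] by (meson subsetD)
      ultimately obtain s where s: "g s = r 0" "\<forall>a. s - (\<Sum>k<a. x k) \<in> V (m + a)"
        using x(2) by (rule series_lift)
      then have "s \<in> B"
        using spec[OF s(2), of 0] S_sum[of x, OF x(1)] by (auto simp: B_def)
      moreover have "y = g s" using s(1) r[rule_format, of 0] by simp
      ultimately show "y \<in> g ` B" by blast
    qed
  qed
qed

text \<open>The previous lemma works near 0 only. Compactness cuts \<open>K\<close> into finitely
  many pieces near points \<open>g x\<close>; each is moved to 0, lifted, and moved back into
  \<open>U\<close>.\<close>

lemma lift_compact:
  assumes "compact K" "open U" "K \<subseteq> g ` U"
  obtains B where "totally_bounded B" "B \<subseteq> U" "K \<subseteq> g ` B"
proof -
  have "\<forall>n. \<exists>k. W k \<subseteq> closure (g ` V (Suc (Suc n)))"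
    using nearly_open by blast
  then obtain N where N: "\<forall>n. W (N n) \<subseteq> closure (g ` V (Suc (Suc n)))"
    by metis
  \<comment> \<open>Pairs whose basic neighbourhood \<open>x + V n\<close> fits into
    \<open>U\<close>; \<open>G\<close> gives the matching open set around \<open>g x\<close>, small
    enough for lifting into \<open>V n\<close>.\<close>
  define I where "I = {(x, n). {z. z - x \<in> V n} \<subseteq> U}"
  define G where "G i = {z. z - g (fst i) \<in> W (N (snd i))}" for i
  have "\<exists>x n. (x, n) \<in> I \<and> y = g x" if "y \<in> K" for y
  proof -
    obtain x where x: "x \<in> U" "y = g x" using assms(3) \<open>y \<in> K\<close> by blast
    have "open {z. z + x \<in> U}" "0 \<in> {z. z + x \<in> U}"
      using open_translate[OF assms(2), of "- x"] x by simp_all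
    then obtain n where "V n \<subseteq> {z. z + x \<in> U}" using E.V_base by blast
    then have "(x, n) \<in> I" by (auto simp: I_def)
    with x show ?thesis by blast
  qed
  then have "K \<subseteq> (\<Union>i\<in>I. G i)"
    using F.V_0 by (fastforce simp: G_def)
  moreover have "open (G i)" for i
    unfolding G_def by (rule open_translate[OF F.V_open])
  ultimately obtain J where J: "J \<subseteq> I" "finite J" "K \<subseteq> (\<Union>i\<in>J. G i)"
    using compactE_image[OF assms(1), of I G] by metis
  have "\<exists>B. totally_bounded B \<and> B \<subseteq> U \<and> K \<inter> G i \<subseteq> g ` B" if "i \<in> J" for i
  proof -
    obtain x n where i: "i = (x, n)" by force
    let ?T = "(\<lambda>t. t - g x) ` (K \<inter> G i)"
    have "totally_bounded (K \<inter> G i)"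
      using F.compact_imp_totally_bounded_tvs[OF assms(1)] by (rule totally_bounded_subset) simp
    then have "totally_bounded ?T" by (rule F.totally_bounded_translate)
    moreover have "?T \<subseteq> closure (g ` V (Suc (Suc n)))"
      using N by (auto simp: G_def i)
    ultimately obtain B where B: "totally_bounded B" "B \<subseteq> V n" "?T \<subseteq> g ` B"
      by (rule lift_totally_bounded)
    have "{z. z - x \<in> V n} \<subseteq> U"
      using J(1) \<open>i \<in> J\<close> by (auto simp: I_def i)
    moreover have "(\<lambda>b. b - - x) ` B \<subseteq> {z. z - x \<in> V n}"
      using B(2) by auto
    ultimately have "(\<lambda>b. b - - x) ` B \<subseteq> U" by (rule order_trans[rotated])
    moreover have "K \<inter> G i \<subseteq> g ` (\<lambda>b. b - - x) ` B"
    proof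
      fix y assume "y \<in> K \<inter> G i"
      then have "y - g x \<in> g ` B" using B(3) by blast
      then obtain b where "b \<in> B" "y - g x = g b" by blast
      then have "y = g b + g x" by (metis diff_add_cancel)
      then have "y = g (b - - x)" by (simp add: linear_add[OF lin])
      with \<open>b \<in> B\<close> show "y \<in> g ` (\<lambda>b. b - - x) ` B" by blast
    qed
    ultimately show ?thesis
      using E.totally_bounded_translate[OF B(1), of "- x"] by blast
  qed
  then obtain B where B: "\<And>i. i \<in> J \<Longrightarrow> totally_bounded (B i) \<and> B i \<subseteq> U \<and> K \<inter> G i \<subseteq> g ` B i"
    by metis
  show ?thesis
  proof
    show "totally_bounded (\<Union>i\<in>J. B i)"
      using B J(2) by (intro totally_bounded_Union) auto
    show "(\<Union>i\<in>J. B i) \<subseteq> U" using B by blast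
    show "K \<subseteq> g ` (\<Union>i\<in>J. B i)"
    proof
      fix y assume "y \<in> K"
      then obtain i where i: "i \<in> J" "y \<in> K \<inter> G i" using J(3) by blast
      then have "y \<in> g ` B i" using B by (meson subsetD)
      with i(1) show "y \<in> g ` (\<Union>i\<in>J. B i)" by blast
    qed
  qed
qed

section \<open>The alternating series and surjectivity of the sum over the reals\<close>

lemma perturbation:
  fixes f :: "'e \<Rightarrow> 'f"
  assumes f: "linear f" "continuous_on UNIV f" and U: "open U" "0 \<in> U"
    and K: "compact (closure (f ` U))" "closure (f ` U) \<subseteq> (*\<^sub>R) (1/2) ` g ` U"
  shows "surj (\<lambda>x. f x + g x)"
proof -
  let ?h = "\<lambda>x. f x + g x"
  have lin_h: "linear ?h" using f(1) lin by (rule linear_compose_add)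
  define K' where "K' = (*\<^sub>R) 2 ` closure (f ` U)"
  have "compact K'"
    unfolding K'_def
    by (rule compact_continuous_image[OF _ K(1)])
      (auto simp: continuous_on_def intro!: F.tendsto_scaleR_tvs tendsto_ident_at)
  moreover have "K' \<subseteq> g ` U" using K(2) by (auto simp: K'_def)
  ultimately obtain B where B: "totally_bounded B" "B \<subseteq> U" "K' \<subseteq> g ` B"
    using lift_compact U(1) by metis
  have "\<exists>v\<in>B. f u = (1/2) *\<^sub>R g v" if "u \<in> U" for u
  proof -
    have "2 *\<^sub>R f u \<in> K'" using closure_subset[of "f ` U"] that by (auto simp: K'_def)
    then obtain v where v: "v \<in> B" "2 *\<^sub>R f u = g v" using B(3) by blast
    then have "f u = (1/2) *\<^sub>R g v" by (simp flip: v(2))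
    with v(1) show ?thesis by blast
  qed
  then obtain \<phi> where \<phi>: "\<And>u. u \<in> U \<Longrightarrow> \<phi> u \<in> B" "\<And>u. u \<in> U \<Longrightarrow> f u = (1/2) *\<^sub>R g (\<phi> u)"
    by metis
  have fU: "f u \<in> range ?h" if "u \<in> U" for u
  proof -
    define v where "v n = (\<phi> ^^ n) u" for n
    have v0: "v 0 = u" and v_Suc: "v (Suc n) = \<phi> (v n)" for n by (simp_all add: v_def)
    have vU: "v n \<in> U" for n
      using that \<phi>(1) B(2) by (induction n) (auto simp: v0 v_Suc)
    then have vB: "v (Suc n) \<in> B" for n using \<phi>(1) by (simp add: v_Suc)
    have gv: "g (v (Suc n)) = 2 *\<^sub>R f (v n)" for n using \<phi>(2)[OF vU] by (simp add: v_Suc)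
    \<comment> \<open>With \<open>c n = (-1/2)^n\<close>, the \<open>g\<close> part of each new term
      cancels the remainder \<open>c n *\<^sub>R f (v n)\<close> and its \<open>f\<close> part is
      the next remainder. The terms start at \<open>v 1\<close> because \<open>v 0 = u\<close> need
      not lie in \<open>B\<close>.\<close>
    define c where "c n = (- 1 :: real) ^ n / 2 ^ n" for n
    define S where "S n = (\<Sum>k<n. (c k / 2) *\<^sub>R v (Suc k))" for n
    have hS: "?h (S n) = f u - c n *\<^sub>R f (v n)" for n
      by (induction n)
        (simp_all add: S_def c_def v0 gv linear_0[OF f(1)] linear_0[OF lin] linear_add[OF f(1)]
          linear_add[OF lin] linear_scale[OF f(1)] linear_scale[OF lin] algebra_simps)
    obtain s where s: "S \<longlonglongrightarrow> s"
    proof (rule E.Cauchy_converges)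
      fix n
      obtain N where N: "\<forall>b\<in>B. (1 / 2 ^ N) *\<^sub>R b \<in> V n"
        using E.totally_bounded_imp_absorbed[OF B(1)] by blast
      have "S (N + m) - S N \<in> V n" for m
      proof -
        have "(\<Sum>j<m. (c (N + j) / 2) *\<^sub>R v (Suc (N + j))) \<in> V n"
        proof (rule half_sums_mem_convex[OF E.V_convex E.V_0])
          fix j
          let ?b = "(1 / 2 ^ N) *\<^sub>R v (Suc (N + j))"
          have b: "?b \<in> V n" using N vB by blast
          \<comment> \<open>The powers of 2 needed for \<open>half_sums_mem_convex\<close> leave
            exactly \<open>2^-N\<close> up to sign, and that factor sends all of \<open>B\<close>
            into \<open>V n\<close>.\<close>
          have "2 ^ Suc j * (c (N + j) / 2) = (- 1) ^ (N + j) * (1 / 2 ^ N)"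
            by (simp add: c_def power_add)
          then have "2 ^ Suc j *\<^sub>R (c (N + j) / 2) *\<^sub>R v (Suc (N + j)) = (- 1) ^ (N + j) *\<^sub>R ?b"
            by simp
          also have "\<dots> \<in> V n"
            using b E.V_uminus[OF b] by (cases "even (N + j)") auto
          finally show "2 ^ Suc j *\<^sub>R (c (N + j) / 2) *\<^sub>R v (Suc (N + j)) \<in> V n" .
        qed
        moreover have "S (N + m) = S N + (\<Sum>j<m. (c (N + j) / 2) *\<^sub>R v (Suc (N + j)))"
          by (induction m) (simp_all add: S_def add_ac)
        ultimately show ?thesis by simp
      qed
      then show "\<exists>N. \<forall>m\<ge>N. S m - S N \<in> V n" by (metis le_add_diff_inverse)
    qed
    \<comment> \<open>The \<open>f (v n)\<close> stay in a compact, hence bounded, set, while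
      \<open>c n\<close> tends to 0.\<close>
    have "(\<lambda>n. c n *\<^sub>R f (v n)) \<longlonglongrightarrow> 0"
    proof (rule topological_tendstoI)
      fix G :: "'f set" assume "open G" "0 \<in> G"
      then obtain j where j: "W j \<subseteq> G" using F.V_base by blast
      have "totally_bounded (closure (f ` U))"
        using K(1) by (rule F.compact_imp_totally_bounded_tvs)
      then obtain N where N: "\<forall>y\<in>closure (f ` U). (1 / 2 ^ N) *\<^sub>R y \<in> W j"
        by (rule F.totally_bounded_imp_absorbed)
      have "c n *\<^sub>R f (v n) \<in> W j" if "n \<ge> N" for n
      proof -
        let ?b = "(1 / 2 ^ N) *\<^sub>R f (v n)"
        have "?b \<in> W j" using N vU[of n] closure_subset[of "f ` U"] by blast
        then have b: "(1 / 2 ^ (n - N)) *\<^sub>R ?b \<in> W j"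
          by (rule convex_scaleR_mem[OF F.V_convex F.V_0]) auto
        have "(1 / 2 ^ (n - N)) *\<^sub>R ?b = (1 / 2 ^ n) *\<^sub>R f (v n)"
          using that by (simp flip: power_add)
        then show ?thesis
          using b F.V_uminus[OF b] by (cases "even n") (auto simp: c_def)
      qed
      then show "\<forall>\<^sub>F n in sequentially. c n *\<^sub>R f (v n) \<in> G"
        using j by (intro eventually_sequentiallyI[of N]) blast
    qed
    then have "(\<lambda>n. ?h (S n)) \<longlonglongrightarrow> f u - 0"
      unfolding hS by (intro tendsto_diff tendsto_const)
    moreover have "(\<lambda>n. ?h (S n)) \<longlonglongrightarrow> ?h s"
      using continuous_on_tendsto_compose[OF f(2) s] continuous_on_tendsto_compose[OF cont s]
      by (intro tendsto_add) simp_all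
    ultimately have "f u = ?h s" using F.LIMSEQ_unique_tvs by force
    then show ?thesis by blast
  qed
  \<comment> \<open>\<open>U\<close> is absorbing, so a small multiple of \<open>x\<close> lies in
    \<open>U\<close>; linearity of \<open>?h\<close> scales back.\<close>
  have f_range: "f x \<in> range ?h" for x
  proof -
    obtain n where n: "V n \<subseteq> U" using E.V_base U by blast
    obtain j where "\<forall>u\<in>{x}. (1 / 2 ^ j) *\<^sub>R u \<in> V n"
      by (rule E.totally_bounded_imp_absorbed[of "{x}"]) (simp add: E.compact_imp_totally_bounded_tvs)
    then have "f ((1 / 2 ^ j) *\<^sub>R x) \<in> range ?h" using fU n by blast
    then obtain s where s: "f ((1 / 2 ^ j) *\<^sub>R x) = ?h s" by blast
    have "f x = 2 ^ j *\<^sub>R f ((1 / 2 ^ j) *\<^sub>R x)" by (simp add: linear_scale[OF f(1)])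
    also have "\<dots> = ?h (2 ^ j *\<^sub>R s)" unfolding s by (simp only: linear_scale[OF lin_h])
    finally show ?thesis by blast
  qed
  have "y \<in> range ?h" for y
  proof -
    obtain x where x: "y = g x" using surj by blast
    obtain s where "f x = ?h s" using f_range by blast
    then have "y = ?h (x - s)" by (simp add: x linear_diff[OF lin_h])
    then show ?thesis by blast
  qed
  then show ?thesis by blast
qed

end

section \<open>Transfer to the given scalar field\<close>

theorem lemma3:
  fixes scaleE :: "'k::real_normed_field \<Rightarrow>
      'e::{real_vector, topological_ab_group_add, uniform_space} \<Rightarrow> 'e"
    and scaleF :: "'k \<Rightarrow>
      'f::{real_vector, topological_ab_group_add, uniform_space} \<Rightarrow> 'f"
    and f g h :: "'e \<Rightarrow> 'f"
  assumes "frechet_space scaleE" and "frechet_space scaleF"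
    and "Vector_Spaces.linear scaleE scaleF f" and "continuous_on UNIV f"
    and "Vector_Spaces.linear scaleE scaleF g" and "continuous_on UNIV g"
    and "surj g"
    and "\<exists>U. open U \<and> 0 \<in> U \<and> uminus ` U = U \<and> compact (closure (f ` U)) \<and>
           closure (f ` U) \<subseteq> scaleF (1/2) ` (g ` U)"
    and "h = (\<lambda>x. f x + g x)"
  shows "surj h"
proof -
  interpret E: frechet_space scaleE by fact
  interpret F: frechet_space scaleF by fact
  obtain V :: "nat \<Rightarrow> 'e set" where "frechet_base V"
    using ex_frechet_base frechet_space_scaleR[OF assms(1)] by blast
  then interpret VE: frechet_base V .
  obtain W :: "nat \<Rightarrow> 'f set" where "frechet_base W"
    using ex_frechet_base frechet_space_scaleR[OF assms(2)] by blast
  then interpret WF: frechet_base W .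
  have fg: "linear f" "linear g"
    using assms linear_scaleR E.topological_vector_space_axioms F.topological_vector_space_axioms
    by blast+
  interpret frechet_surjection V W g
    by (intro frechet_surjection.intro frechet_surjection_axioms.intro VE.frechet_base_axioms
        WF.frechet_base_axioms fg(2) assms(6,7))
  have half: "scaleF (1/2) = (*\<^sub>R) (1/2)"
  proof
    show "scaleF (1/2) y = (1/2) *\<^sub>R y" for y
      using F.of_real_scale[of "1/2" y] by simp
  qed
  from assms(8)[unfolded half] obtain U where U: "open U" "0 \<in> U" "compact (closure (f ` U))"
    "closure (f ` U) \<subseteq> (*\<^sub>R) (1/2) ` g ` U"
    by (elim exE conjE) (rule that)
  show ?thesis
    unfolding assms(9) by (rule perturbation[OF fg(1) assms(4) U])
qed

end
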